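(* Let $\lambda$ be a nonzero real number and let $r\ge0$ be an integer. For every integer $m\ge0$, as power series in $x$, $$\sum_{n=0}^{\infty}H_{n,\lambda}(n+r)_{m,\lambda}x^{n}=\frac{1}{1-x}\sum_{k=0}^{m}{m+r \brace k+r}_{r,\lambda}k!\left(\frac{x}{1-x}\right)^{k}\left(H_{k,\lambda}-\binom{k-\lambda}{k}\log_{\lambda}(1-x)\right).$$
   Context: For real $a$ and integer $k\ge0$, $\binom{a}{k}=a(a-1)\cdots(a-k+1)/k!$. Falling factorials: $(y)_0=1$, $(y)_n=y(y-1)\cdots(y-n+1)$; degenerate falling factorials: $(y)_{0,\lambda}=1$, $(y)_{n,\lambda}=y(y-\lambda)\cdots(y-(n-1)\lambda)$ for $n\ge1$. Degenerate harmonic numbers: $H_{0,\lambda}=0$ and $H_{n,\lambda}=\sum_{k=1}^{n}\frac{1}{\lambda}\binom{\lambda}{k}(-1)^{k-1}$ for $n\ge1$. The degenerate logarithm $\log_\lambda t$ is the compositional inverse of the degenerate exponential $e_\lambda(t)=\sum_{n\ge0}\frac{(1)_{n,\lambda}}{n!}t^n$; explicitly, $\log_\lambda(1+t)=\sum_{n=1}^{\infty}\frac{\lambda^{n-1}(1)_{n,1/\lambda}}{n!}t^n$ as a power series in $t$. The degenerate $r$-Stirling numbers of the second kind ${n+r \brace k+r}_{r,\lambda}$ ($0\le k\le n$) are defined by the polynomial identity $(y+r)_{n,\lambda}=\sum_{k=0}^{n}{n+r \brace k+r}_{r,\lambda}(y)_{k}$ for $n\ge0$. *)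

theory Defs
  imports "HOL-Computational_Algebra.Computational_Algebra"
begin

definition ffact :: "real \<Rightarrow> nat \<Rightarrow> real" where
  "ffact y n = (\<Prod>i<n. y - real i)"

definition deg_ffact :: "real \<Rightarrow> real \<Rightarrow> nat \<Rightarrow> real" where
  "deg_ffact l y n = (\<Prod>i<n. y - real i * l)"

definition deg_harmonic :: "real \<Rightarrow> nat \<Rightarrow> real" where
  "deg_harmonic l n = (\<Sum>k=1..n. 1 / l * (l gchoose k) * (-1) ^ (k - 1))"

definition deg_exp :: "real \<Rightarrow> real fps" where
  "deg_exp l = Abs_fps (\<lambda>n. deg_ffact l 1 n / fact n)"

text \<open>
  The series of \<open>log\<^sub>\<lambda> (1 + t)\<close> in \<open>t\<close>. The degenerate exponential has constant term 1, so
  \<open>log\<^sub>\<lambda>\<close> being its inverse means that \<open>log\<^sub>\<lambda> (1 + t)\<close> inverts \<open>e\<^sub>\<lambda> (t) - 1\<close> under composition.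
  The explicit coefficients are derived below in \<open>deg_log1p_explicit\<close>.
\<close>
definition deg_log1p :: "real \<Rightarrow> real fps" where
  "deg_log1p l = fps_inv (deg_exp l - 1)"

text \<open>
  The number with upper entry \<open>n + r\<close> and lower entry \<open>k + r\<close> is \<open>deg_rStirling2 l r n k\<close>,
  without the shift by \<open>r\<close> in the arguments. The condition beyond \<open>n\<close> only makes the function
  unique; existence and uniqueness are shown in \<open>deg_rStirling2_unique\<close>.
\<close>
definition deg_rStirling2 :: "real \<Rightarrow> nat \<Rightarrow> nat \<Rightarrow> nat \<Rightarrow> real" where
  "deg_rStirling2 l r n = (THE S. (\<forall>k>n. S k = 0) \<and>
     (\<forall>y. deg_ffact l (y + real r) n = (\<Sum>k=0..n. S k * ffact y k)))"

lemma ffact_of_nat_eq_0: "j < k \<Longrightarrow> ffact (real j) k = 0"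
  unfolding ffact_def by (rule prod_zero) auto

lemma ffact_of_nat_neq_0: "ffact (real j) j \<noteq> 0"
  by (simp add: ffact_def)

lemma ffact_Suc: "ffact y (Suc k) = ffact y k * (y - real k)"
  by (simp add: ffact_def)

lemma ffact_expansion_zero:
  assumes "\<And>y. (\<Sum>k=0..n. T k * ffact y k) = 0" and "j \<le> n"
  shows "T j = 0"
  using assms(2)
proof (induction j rule: less_induct)
  case (less j)
  have "(\<Sum>k=0..n. T k * ffact (real j) k) = (\<Sum>k=0..n. if k = j then T j * ffact (real j) j else 0)"
  proof (intro sum.cong refl)
    fix k assume "k \<in> {0..n}"
    then show "T k * ffact (real j) k = (if k = j then T j * ffact (real j) j else 0)"
      using less.IH[of k] by (cases "k < j"; cases "k = j") (auto simp: ffact_of_nat_eq_0)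
  qed
  also have "\<dots> = T j * ffact (real j) j"
    using less.prems by simp
  finally show ?case
    using assms(1)[of "real j"] ffact_of_nat_neq_0[of j] by simp
qed

lemma deg_rStirling2_exists:
  "\<exists>S. (\<forall>k>n. S k = 0) \<and> (\<forall>y. deg_ffact l (y + real r) n = (\<Sum>k=0..n. S k * ffact y k))"
proof (induction n)
  case 0
  show ?case
    by (rule exI[of _ "\<lambda>k. if k = 0 then 1 else 0"]) (auto simp: deg_ffact_def ffact_def)
next
  case (Suc n)
  then obtain S where S0: "\<And>k. k > n \<Longrightarrow> S k = 0"
    and S: "\<And>y. deg_ffact l (y + real r) n = (\<Sum>k=0..n. S k * ffact y k)" by blast
  define T where "T k = (if k = 0 then 0 else S (k - 1)) + (real k + real r - real n * l) * S k" for k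
  have "deg_ffact l (y + real r) (Suc n) = (\<Sum>k=0..Suc n. T k * ffact y k)" for y
  proof -
    have "deg_ffact l (y + real r) (Suc n) = (\<Sum>k=0..n. S k * ffact y k) * (y + real r - real n * l)"
      unfolding S[symmetric] by (simp add: deg_ffact_def)
    also have "\<dots> = (\<Sum>k=0..n. S k * ffact y (Suc k) + (real k + real r - real n * l) * S k * ffact y k)"
      unfolding sum_distrib_right by (intro sum.cong refl) (simp add: ffact_Suc algebra_simps)
    also have "\<dots> = (\<Sum>k=0..n. S k * ffact y (Suc k)) +
        (\<Sum>k=0..Suc n. (real k + real r - real n * l) * S k * ffact y k)"
      by (simp add: sum.distrib S0)
    also have "(\<Sum>k=0..n. S k * ffact y (Suc k)) =
        (\<Sum>k=0..Suc n. (if k = 0 then 0 else S (k - 1)) * ffact y k)"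
      unfolding sum.atLeast0_atMost_Suc_shift[where n = n] by simp
    finally show ?thesis
      by (simp only: T_def distrib_right sum.distrib)
  qed
  moreover have "T k = 0" if "k > Suc n" for k
    using that S0[of k] S0[of "k - 1"] by (simp add: T_def)
  ultimately show ?case by blast
qed

lemma deg_rStirling2_unique:
  "\<exists>!S. (\<forall>k>n. S k = 0) \<and> (\<forall>y. deg_ffact l (y + real r) n = (\<Sum>k=0..n. S k * ffact y k))"
proof (rule ex_ex1I[OF deg_rStirling2_exists])
  fix S T
  assume S: "(\<forall>k>n. S k = 0) \<and> (\<forall>y. deg_ffact l (y + real r) n = (\<Sum>k=0..n. S k * ffact y k))"
    and T: "(\<forall>k>n. T k = 0) \<and> (\<forall>y. deg_ffact l (y + real r) n = (\<Sum>k=0..n. T k * ffact y k))"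
  have "(\<Sum>k=0..n. (S k - T k) * ffact y k) = 0" for y
    using S T by (metis (no_types, lifting) diff_self left_diff_distrib sum.cong sum_subtractf)
  from ffact_expansion_zero[of "\<lambda>k. S k - T k", OF this] have "S k = T k" if "k \<le> n" for k
    using that by simp
  with S T show "S = T"
    by (metis ext leI)
qed

lemma deg_rStirling2_eq_0: "k > n \<Longrightarrow> deg_rStirling2 l r n k = 0"
  and deg_ffact_eq_sum_deg_rStirling2:
    "deg_ffact l (y + real r) n = (\<Sum>k=0..n. deg_rStirling2 l r n k * ffact y k)"
  using theI'[OF deg_rStirling2_unique[of n l r]] unfolding deg_rStirling2_def by blast+

lemma deg_log1p_explicit:
  assumes "l \<noteq> 0"
  shows "deg_log1p l = Abs_fps (\<lambda>n. if n = 0 then 0 else l ^ (n - 1) * deg_ffact (1 / l) 1 n / fact n)"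
    (is "_ = ?L")
proof -
  let ?E = "deg_exp l - 1"
  have E0: "?E $ 0 = 0" and E1: "?E $ 1 \<noteq> 0"
    by (simp_all add: deg_exp_def deg_ffact_def)
  have L0: "?L $ 0 = 0" by simp
  have coeff: "l * (?L $ n) = (l gchoose n)" if "n > 0" for n
  proof -
    have "l ^ n * deg_ffact (1 / l) 1 n = (\<Prod>i<n. l) * (\<Prod>i<n. 1 - real i * (1 / l))"
      by (simp add: deg_ffact_def)
    also have "\<dots> = (\<Prod>i<n. l - real i)"
      unfolding prod.distrib[symmetric] using assms by (intro prod.cong refl) (simp add: field_simps)
    finally have *: "l ^ n * deg_ffact (1 / l) 1 n = (\<Prod>i<n. l - real i)" .
    have "l * (?L $ n) = l ^ n * deg_ffact (1 / l) 1 n / fact n"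
      using that by (cases n) simp_all
    then show ?thesis
      unfolding * by (simp add: gbinomial_prod_rev atLeast0LessThan)
  qed
  have binL: "1 + fps_const l * ?L = fps_binomial l"
  proof (rule fps_ext)
    fix n show "(1 + fps_const l * ?L) $ n = fps_binomial l $ n"
      using coeff[of n] by (cases "n = 0") simp_all
  qed
  have X1: "(1 + fps_X :: real fps) dvd f" for f
    by (rule unit_imp_dvd) simp
  have X0: "(1 + fps_X :: real fps) \<noteq> 0"
    using X1[of 1] by auto
  have "fps_const l * fps_deriv ?L = fps_deriv (fps_binomial l)"
    unfolding binL[symmetric] by simp
  also have "\<dots> * (1 + fps_X) = fps_const l * fps_binomial l"
    using X1 by (simp add: fps_binomial_deriv)
  finally have dL: "fps_deriv ?L * (1 + fps_X) = fps_binomial l"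
    using assms by (simp add: mult.assoc)
  have dE: "fps_deriv ?E * (1 + fps_const l * fps_X) = 1 + ?E"
  proof (rule fps_ext)
    fix n
    show "(fps_deriv ?E * (1 + fps_const l * fps_X)) $ n = (1 + ?E) $ n"
      by (cases n) (simp_all add: deg_exp_def deg_ffact_def field_simps del: of_nat_Suc)
  qed
  let ?F = "1 + (?E oo ?L)"
  have "(fps_deriv ?E * (1 + fps_const l * fps_X)) oo ?L = (1 + ?E) oo ?L"
    by (simp only: dE)
  then have EB: "(fps_deriv ?E oo ?L) * fps_binomial l = ?F"
    by (simp only: fps_compose_mult_distrib[OF L0] fps_compose_add_distrib fps_compose_1
        fps_const_compose fps_X_fps_compose_startby0[OF L0] binL)
  have "fps_deriv ?F * (1 + fps_X) = ?F"
    by (simp only: fps_deriv_add fps_deriv_1 add_0_left fps_compose_deriv[OF L0] mult.assoc dL EB)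
  then have "?F / (1 + fps_X) = fps_deriv ?F * (1 + fps_X) / (1 + fps_X)"
    by (simp only:)
  also have "\<dots> = fps_deriv ?F"
    by (rule nonzero_mult_div_cancel_right[OF X0])
  finally have "fps_deriv ?F = fps_const 1 * ?F / (1 + fps_X)"
    by (simp only: fps_const_1_eq_1 mult_1)
  moreover have "?F $ 0 = 1"
    using E0 by simp
  ultimately have "?F = fps_binomial 1"
    using iffD1[OF fps_binomial_ODE_unique'[of ?F 1]] by (simp only: simp_thms)
  then have F: "?E oo ?L = fps_X"
    by (simp add: fps_binomial_1)
  have "fps_inv ?E = fps_inv ?E oo (?E oo ?L)"
    unfolding F by simp
  also have "\<dots> = (fps_inv ?E oo ?E) oo ?L"
    by (rule fps_compose_assoc[OF L0 E0])
  also have "\<dots> = ?L"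
    unfolding fps_inv[OF E0 E1] by (rule fps_X_fps_compose_startby0[OF L0])
  finally show ?thesis
    by (simp only: deg_log1p_def)
qed

end

theory Submission
  imports Defs
begin

text \<open>
  Both ingredients of the identity are binomial in disguise: \<open>l * log\<^sub>l (1 - x) = (1 - x)\<^sup>l - 1\<close>, and
  the alternating row sum of binomial coefficients gives \<open>l * H\<^sub>n = 1 - ((n - l) gchoose n)\<close>.
  Expanding \<open>(n + r)\<^sub>m\<^sub>,\<^sub>l\<close> in ordinary falling factorials \<open>(n)\<^sub>k = k! (n choose k)\<close>, which is what
  the \<open>r\<close>-Stirling numbers are for, leaves one generating function for each \<open>k\<close>, that of
  \<open>H\<^sub>n (n choose k)\<close>; this is \<open>fps_deg_harmonic_binomial\<close>.

  There the term \<open>1\<close> of \<open>l * H\<^sub>n\<close> contributes \<open>x\<^sup>k (1 - x)\<^sup>-\<^sup>k\<^sup>-\<^sup>1\<close>, and trinomial revision splits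
  \<open>((n - l) gchoose n) (n choose k)\<close> into the constant \<open>(k - l) gchoose k\<close> and the coefficients of
  \<open>x\<^sup>k (1 - x)\<^sup>l\<^sup>-\<^sup>k\<^sup>-\<^sup>1\<close>. With the factor \<open>x\<^sup>k (1 - x)\<^sup>-\<^sup>k\<^sup>-\<^sup>1\<close> taken out there remains
  \<open>1 - ((k - l) gchoose k) (1 - x)\<^sup>l\<close>, and substituting the two formulas back turns this into
  \<open>l\<close> times the bracket \<open>H\<^sub>k - ((k - l) gchoose k) log\<^sub>l (1 - x)\<close>.
\<close>

definition one_minus_X_powr :: "real \<Rightarrow> real fps" where
  "one_minus_X_powr c = fps_binomial c oo (- fps_X)"

lemma one_minus_X_powr_nth: "one_minus_X_powr c $ n = (-1) ^ n * (c gchoose n)"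
  by (simp add: one_minus_X_powr_def fps_compose_uminus')

lemma one_minus_X_powr_add:
  "one_minus_X_powr (a + b) = one_minus_X_powr a * one_minus_X_powr b"
  by (simp add: one_minus_X_powr_def fps_binomial_add_mult fps_compose_mult_distrib)

lemma inverse_one_minus_X_eq: "inverse (1 - fps_X) = one_minus_X_powr (-1)"
proof (rule fps_inverse_unique)
  have "one_minus_X_powr 1 = 1 - fps_X"
    by (simp add: one_minus_X_powr_def fps_binomial_1 fps_compose_add_distrib)
  moreover have "one_minus_X_powr (1 + (-1)) = 1"
    by (simp add: one_minus_X_powr_def)
  ultimately show "(1 - fps_X) * one_minus_X_powr (-1) = 1"
    by (simp only: one_minus_X_powr_add)
qed

lemma prefactor_eq:
  "1 / (1 - fps_X) * (fps_X / (1 - fps_X)) ^ k = fps_X ^ k * one_minus_X_powr (- real k - 1)"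
proof (induction k)
  case 0
  show ?case
    by (simp add: fps_divide_unit inverse_one_minus_X_eq)
next
  case (Suc k)
  have "1 / (1 - fps_X) * (fps_X / (1 - fps_X)) ^ Suc k =
      (1 / (1 - fps_X) * (fps_X / (1 - fps_X)) ^ k) * (fps_X * one_minus_X_powr (-1))"
    by (simp add: fps_divide_unit inverse_one_minus_X_eq mult_ac)
  also have "\<dots> = fps_X ^ Suc k * one_minus_X_powr ((- real k - 1) + (-1))"
    unfolding Suc.IH one_minus_X_powr_add by (simp add: mult_ac)
  finally show ?case
    by (simp add: algebra_simps)
qed

text \<open>
  The two powers of \<open>1 - x\<close> in the main argument have exponents \<open>- k - 1\<close> and \<open>l - k - 1\<close>, so \<open>c\<close>
  is \<open>0\<close> or \<open>l\<close>. Negating the upper index absorbs the sign and makes it \<open>n - c\<close>, free of \<open>k\<close>.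
\<close>
lemma fps_X_power_mult_one_minus_X_powr_nth:
  "(fps_X ^ k * one_minus_X_powr (c - real k - 1)) $ n =
    (if n < k then 0 else (real n - c) gchoose (n - k))"
proof (cases "n < k")
  case False
  then have "(real n - c) gchoose (n - k) = (-1) ^ (n - k) * ((c - real k - 1) gchoose (n - k))"
    by (subst gbinomial_negated_upper) (simp add: of_nat_diff algebra_simps)
  with False show ?thesis
    by (simp add: fps_X_power_mult_nth one_minus_X_powr_nth)
qed (simp add: fps_X_power_mult_nth)

lemma deg_log1p_eq_fps_binomial:
  assumes "l \<noteq> 0"
  shows "fps_const l * deg_log1p l = fps_binomial l - 1"
proof (rule fps_ext)
  fix n
  have "l ^ n * deg_ffact (1 / l) 1 n = (\<Prod>i<n. l) * (\<Prod>i<n. 1 - real i * (1 / l))"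
    by (simp add: deg_ffact_def)
  also have "\<dots> = (\<Prod>i<n. l - real i)"
    unfolding prod.distrib[symmetric] using assms by (intro prod.cong refl) (simp add: field_simps)
  finally have *: "l ^ n * deg_ffact (1 / l) 1 n = (\<Prod>i<n. l - real i)" .
  show "(fps_const l * deg_log1p l) $ n = (fps_binomial l - 1) $ n"
  proof (cases n)
    case (Suc j)
    then have "l * deg_log1p l $ n = l ^ n * deg_ffact (1 / l) 1 n / fact n"
      by (simp add: deg_log1p_explicit[OF assms])
    also have "\<dots> = l gchoose n"
      unfolding * by (simp add: gbinomial_prod_rev atLeast0LessThan)
    finally show ?thesis
      using Suc by simp
  qed (simp add: deg_log1p_explicit[OF assms])
qed

lemma deg_log1p_compose_neg_X:
  assumes "l \<noteq> 0"
  shows "fps_const l * (deg_log1p l oo (- fps_X)) = one_minus_X_powr l - 1"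
proof -
  have "fps_const l * (deg_log1p l oo (- fps_X)) = (fps_const l * deg_log1p l) oo (- fps_X)"
    by (simp add: fps_compose_mult_distrib)
  then show ?thesis
    by (simp add: deg_log1p_eq_fps_binomial[OF assms] one_minus_X_powr_def fps_compose_sub_distrib)
qed

text \<open>
  Up to sign and the missing term \<open>k = 0\<close>, the left-hand side is an alternating partial row sum of
  binomial coefficients, which telescopes to \<open>(-1)\<^sup>n ((l - 1) gchoose n)\<close>.
\<close>
lemma deg_harmonic_closed_form:
  assumes "l \<noteq> 0"
  shows "l * deg_harmonic l n = 1 - ((real n - l) gchoose n)"
proof -
  have "l * deg_harmonic l n = - (\<Sum>k=1..n. (l gchoose k) * (-1) ^ k)"
    unfolding deg_harmonic_def sum_distrib_left sum_negf[symmetric]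
  proof (intro sum.cong refl)
    fix k assume "k \<in> {1..n}"
    then show "l * (1 / l * (l gchoose k) * (-1) ^ (k - 1)) = - ((l gchoose k) * (-1) ^ k)"
      using assms by (cases k) auto
  qed
  also have "\<dots> = 1 - (\<Sum>k\<le>n. (l gchoose k) * (-1) ^ k)"
    by (simp add: atMost_atLeast0 sum.atLeast_Suc_atMost)
  also have "(\<Sum>k\<le>n. (l gchoose k) * (-1) ^ k) = (real n - l) gchoose n"
    unfolding gbinomial_sum_lower_neg by (subst gbinomial_negated_upper[of "real n - l"]) simp
  finally show ?thesis .
qed

text \<open>
  Trinomial revision for the lower index \<open>n - k\<close> instead of \<open>k\<close>: this choice makes the factor
  \<open>(k - l) gchoose k\<close> independent of \<open>n\<close>.
\<close>
lemma gbinomial_mult_binomial: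
  fixes l :: real
  assumes "k \<le> n"
  shows "((real n - l) gchoose n) * real (n choose k) =
    ((real k - l) gchoose k) * ((real n - l) gchoose (n - k))"
  using gbinomial_trinomial_revision[of "n - k" n "real n - l"] assms
  by (simp add: binomial_gbinomial[symmetric] binomial_symmetric[of k n] of_nat_diff mult.commute)

text \<open>
  The case of a single falling factorial, divided by \<open>k!\<close>; the general case is linear in it. Since
  the closed forms have \<open>l\<close> on the left, the identity is compared after multiplication by \<open>l\<close>.
\<close>
lemma fps_deg_harmonic_binomial:
  assumes "l \<noteq> 0"
  shows "Abs_fps (\<lambda>n. deg_harmonic l n * real (n choose k)) =
    1 / (1 - fps_X) * (fps_X / (1 - fps_X)) ^ k *
      (fps_const (deg_harmonic l k)
        - fps_const ((real k - l) gchoose k) * (deg_log1p l oo (- fps_X)))"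
    (is "?A = _ * ?B")
proof -
  define c where "c = ((real k - l) gchoose k)"
  have "fps_const l * ?B = fps_const (l * deg_harmonic l k)
      - fps_const c * (fps_const l * (deg_log1p l oo (- fps_X)))"
    by (simp add: c_def right_diff_distrib mult_ac)
  also have "\<dots> = 1 - fps_const c * one_minus_X_powr l"
    unfolding deg_harmonic_closed_form[OF assms] deg_log1p_compose_neg_X[OF assms] c_def[symmetric]
    by (simp add: algebra_simps flip: fps_const_sub)
  finally have B: "fps_const l * ?B = 1 - fps_const c * one_minus_X_powr l" .
  have "fps_const l * (fps_X ^ k * one_minus_X_powr (- real k - 1) * ?B) =
      fps_X ^ k * one_minus_X_powr (- real k - 1) * (fps_const l * ?B)"
    by (simp only: mult_ac)
  also have "\<dots> = fps_X ^ k * one_minus_X_powr (- real k - 1)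
      - fps_const c * (fps_X ^ k * (one_minus_X_powr l * one_minus_X_powr (- real k - 1)))"
    unfolding B by (simp add: algebra_simps)
  also have "one_minus_X_powr l * one_minus_X_powr (- real k - 1) = one_minus_X_powr (l - real k - 1)"
    unfolding one_minus_X_powr_add[symmetric] by (simp add: algebra_simps)
  also have "fps_X ^ k * one_minus_X_powr (- real k - 1)
      - fps_const c * (fps_X ^ k * one_minus_X_powr (l - real k - 1)) = fps_const l * ?A"
  proof (rule fps_ext)
    fix n
    have "(fps_X ^ k * one_minus_X_powr (- real k - 1)) $ n = real (n choose k)"
      using fps_X_power_mult_one_minus_X_powr_nth[of k 0 n]
      by (simp add: binomial_gbinomial[symmetric] binomial_symmetric[of k n] binomial_eq_0)
    moreover have "c * (fps_X ^ k * one_minus_X_powr (l - real k - 1)) $ n =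
        ((real n - l) gchoose n) * real (n choose k)"
      unfolding fps_X_power_mult_one_minus_X_powr_nth
      by (simp add: c_def gbinomial_mult_binomial binomial_eq_0)
    moreover have "l * (deg_harmonic l n * real (n choose k)) =
        real (n choose k) - ((real n - l) gchoose n) * real (n choose k)"
      by (simp only: mult.assoc[symmetric] deg_harmonic_closed_form[OF assms] left_diff_distrib mult_1)
    ultimately show "(fps_X ^ k * one_minus_X_powr (- real k - 1)
        - fps_const c * (fps_X ^ k * one_minus_X_powr (l - real k - 1))) $ n =
      (fps_const l * ?A) $ n"
      by (simp only: fps_sub_nth fps_mult_left_const_nth fps_nth_Abs_fps)
  qed
  finally show ?thesis
    unfolding prefactor_eq using assms by simp
qed

lemma ffact_of_nat: "ffact (real n) k = fact k * real (n choose k)"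
  by (simp add: ffact_def binomial_gbinomial gbinomial_prod_rev atLeast0LessThan)

theorem theorem9:
  fixes l :: real and r m :: nat
  assumes "l \<noteq> 0"
  shows "Abs_fps (\<lambda>n. deg_harmonic l n * deg_ffact l (real n + real r) m) =
    1 / (1 - fps_X) *
    (\<Sum>k=0..m. fps_const (deg_rStirling2 l r m k * fact k) * (fps_X / (1 - fps_X)) ^ k *
      (fps_const (deg_harmonic l k)
        - fps_const ((real k - l) gchoose k) * (deg_log1p l oo (- fps_X))))"
proof -
  have "Abs_fps (\<lambda>n. deg_harmonic l n * deg_ffact l (real n + real r) m) =
      (\<Sum>k=0..m. fps_const (deg_rStirling2 l r m k * fact k) *
        Abs_fps (\<lambda>n. deg_harmonic l n * real (n choose k)))"
    by (rule fps_ext)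
      (simp add: deg_ffact_eq_sum_deg_rStirling2 ffact_of_nat fps_sum_nth sum_distrib_left mult_ac)
  then show ?thesis
    unfolding fps_deg_harmonic_binomial[OF assms] sum_distrib_left by (simp only: mult_ac)
qed

end
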